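(* Let $\mathbb{F}$ be a field of characteristic not $2$ or $3$, let $B$ be an invertible symmetric $3\times 3$ matrix over $\mathbb{F}$, and let $\overline{A_0A_1A_2A_3}$ be a (non-coplanar) tetrahedron in $\mathbb{A}^3$ over $\mathbb{F}$ with $B$-quadrances $Q_{ij}$ ($0\leq i<j\leq 3$), $B$-quadrume $\mathcal{V}$ and $B$-circumquadrance $R$. Then $$4\mathcal{V}R=A\left(Q_{01}Q_{23},\,Q_{02}Q_{13},\,Q_{03}Q_{12}\right),$$ where $A(a,b,c)=(a+b+c)^2-2(a^2+b^2+c^2)$.
   Context: $\mathbb{A}^3$ is the three-dimensional affine space over $\mathbb{F}$, with associated vector space $\mathbb{V}^3$ of three-dimensional row vectors over $\mathbb{F}$; for points $X,Y$, $\overrightarrow{XY}=Y-X\in\mathbb{V}^3$. The $B$-scalar product is $u\cdot_B v=uBv^T$, and the $B$-quadratic form is $Q_B(v)=v\cdot_B v$. A tetrahedron $\overline{A_0A_1A_2A_3}$ is a set of four points of $\mathbb{A}^3$, here assumed affinely independent (the vectors $\overrightarrow{A_0A_1},\overrightarrow{A_0A_2},\overrightarrow{A_0A_3}$ are linearly independent). The $B$-quadrances are $Q_{ij}=Q_B(\overrightarrow{A_iA_j})$ for $0\leq i<j\leq 3$. The $B$-quadrume is $$\mathcal{V}=\frac12\det\begin{pmatrix}2Q_{01} & Q_{01}+Q_{02}-Q_{12} & Q_{01}+Q_{03}-Q_{13}\\ Q_{01}+Q_{02}-Q_{12} & 2Q_{02} & Q_{02}+Q_{03}-Q_{23}\\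 Q_{01}+Q_{03}-Q_{13} & Q_{02}+Q_{03}-Q_{23} & 2Q_{03}\end{pmatrix}.$$ The midpoint $M_{ij}$ of the edge $\overline{A_iA_j}$ is the point with $\overrightarrow{A_iM_{ij}}=\overrightarrow{M_{ij}A_j}=\frac12\overrightarrow{A_iA_j}$. The $B$-midplane of the edge $\overline{A_iA_j}$ is the set of points $X$ with $\overrightarrow{A_iA_j}\cdot_B\overrightarrow{M_{ij}X}=0$. The six $B$-midplanes ($0\leq i<j\leq 3$) have exactly one common point $C$, called the $B$-circumcentre. The $B$-circumquadrance $R$ is the $B$-quadrance between $C$ and any of the points of the tetrahedron, i.e. $R=Q_B(\overrightarrow{A_iC})$, which has the same value for every $i\in\{0,1,2,3\}$. *)

theory Defs
  imports "HOL-Analysis.Analysis"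
begin

(* Points of the affine space and row vectors of the associated vector space are both
   elements of 'a^3; the vector from X to Y is Y - X. *)

definition bprod :: "'a::field^3^3 \<Rightarrow> 'a^3 \<Rightarrow> 'a^3 \<Rightarrow> 'a" where
  "bprod B u v = ((rowvector u :: 'a^3^1) ** B ** transpose (rowvector v :: 'a^3^1)) $ 1 $ 1"

definition bform :: "'a::field^3^3 \<Rightarrow> 'a^3 \<Rightarrow> 'a" where
  "bform B v = bprod B v v"

definition quadrance :: "'a::field^3^3 \<Rightarrow> 'a^3 \<Rightarrow> 'a^3 \<Rightarrow> 'a" where
  "quadrance B X Y = bform B (Y - X)"

(* Only the values A 0, ..., A 3 matter.  Injectivity is required separately, because
   vec.independent is a property of the set of edge vectors and would not see a repetition. *)
definition tetrahedron :: "(nat \<Rightarrow> 'a::field^3) \<Rightarrow> bool" where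
  "tetrahedron A \<longleftrightarrow> inj_on A {0..3} \<and> vec.independent {A 1 - A 0, A 2 - A 0, A 3 - A 0}"

definition quadrume :: "'a::field^3^3 \<Rightarrow> (nat \<Rightarrow> 'a^3) \<Rightarrow> 'a" where
  "quadrume B A = (let Q = (\<lambda>i j. quadrance B (A i) (A j)) in
     1 / 2 * det (vector
       [vector [2 * Q 0 1,             Q 0 1 + Q 0 2 - Q 1 2, Q 0 1 + Q 0 3 - Q 1 3],
        vector [Q 0 1 + Q 0 2 - Q 1 2, 2 * Q 0 2,             Q 0 2 + Q 0 3 - Q 2 3],
        vector [Q 0 1 + Q 0 3 - Q 1 3, Q 0 2 + Q 0 3 - Q 2 3, 2 * Q 0 3]] :: 'a^3^3))"

definition edge_midpoint :: "'a::field^3 \<Rightarrow> 'a^3 \<Rightarrow> 'a^3" where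
  "edge_midpoint X Y = X + (1 / 2) *s (Y - X)"

definition midplane :: "'a::field^3^3 \<Rightarrow> 'a^3 \<Rightarrow> 'a^3 \<Rightarrow> ('a^3) set" where
  "midplane B X Y = {P. bprod B (Y - X) (P - edge_midpoint X Y) = 0}"

(* For symmetric invertible B, characteristic other than 2 and a nondegenerate tetrahedron,
   the two descriptions below are satisfied by exactly one point and one scalar. *)
definition circumcentre :: "'a::field^3^3 \<Rightarrow> (nat \<Rightarrow> 'a^3) \<Rightarrow> 'a^3" where
  "circumcentre B A = (THE C. \<forall>i j. i < j \<and> j \<le> 3 \<longrightarrow> C \<in> midplane B (A i) (A j))"

definition circumquadrance :: "'a::field^3^3 \<Rightarrow> (nat \<Rightarrow> 'a^3) \<Rightarrow> 'a" where
  "circumquadrance B A = (THE R. \<forall>i\<le>3. R = quadrance B (A i) (circumcentre B A))"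

definition archimedes :: "'a::field \<Rightarrow> 'a \<Rightarrow> 'a \<Rightarrow> 'a" where
  "archimedes a b c = (a + b + c)^2 - 2 * (a^2 + b^2 + c^2)"

end

theory Submission
  imports Defs
begin

text \<open>
  Put the origin at A 0 and write u1, u2, u3 for the edge vectors from it, G for their Gram
  matrix with respect to B and g for the diagonal of G, so that g lists the quadrances of the
  three edges at A 0.  By polarization the matrix whose determinant defines the quadrume is 2 G;
  hence the quadrume is 4 det G.

  A point lies on the midplane of an edge exactly when its quadrances to the two endpoints agree
  (\<open>mem_midplane_iff\<close>).  So the six midplane conditions come down to the three
  for the edges at A 0, which say uj B c = gj / 2 for the position vector c of the circumcentre.
  The matrix of this linear system is the matrix of edge vectors times B, which is invertible;
  this gives the existence and uniqueness that the definite descriptions need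
  (\<open>ex1_equidistant\<close>, \<open>circumcentre_equidistant\<close>).

  Since the edge vectors form a basis, c = x1 u1 + x2 u2 + x3 u3, and the system becomes
  2 G x = g, while the circumquadrance R = c B c satisfies 2 R = g x.  Cramer's rule eliminates x:
  4 R det G is the value at g of the quadratic form of the adjugate of G.  That value, written in
  the quadrances, is a quarter of the Archimedes function of the three products of quadrances of
  opposite edges (\<open>gram_circumradius_identity\<close>).
\<close>

section \<open>The scalar product of a symmetric matrix\<close>

lemma bprod_eq_sum: "bprod B u v = (\<Sum>i\<in>UNIV. u $ i * (B *v v) $ i)"
proof -
  have "(rowvector u ** B ** transpose (rowvector v) :: 'a^1^1)
      = rowvector u ** columnvector (B *v v)"
    by (simp add: transpose_rowvector dot_rowvector_columnvector flip: matrix_mul_assoc)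
  then show ?thesis
    by (simp add: bprod_def matrix_matrix_mult_def rowvector_def columnvector_def)
qed

lemma bprod_add_left: "bprod B (u + v) w = bprod B u w + bprod B v w"
  by (simp add: bprod_eq_sum distrib_right sum.distrib)

lemma bprod_scale_left: "bprod B (k *s u) w = k * bprod B u w"
  by (simp add: bprod_eq_sum sum_distrib_left mult.assoc)

lemma bprod_commute:
  assumes "transpose B = B"
  shows "bprod B u v = bprod B v u"
proof -
  have sym: "B $ i $ j = B $ j $ i" for i j
  proof -
    have "B $ i $ j = transpose B $ i $ j"
      by (simp only: assms)
    then show ?thesis
      by (simp add: transpose_def)
  qed
  have "bprod B u v = (\<Sum>i\<in>UNIV. \<Sum>j\<in>UNIV. u $ i * B $ i $ j * v $ j)"
    by (simp add: bprod_eq_sum matrix_vector_mult_def sum_distrib_left mult.assoc)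
  also have "\<dots> = (\<Sum>j\<in>UNIV. \<Sum>i\<in>UNIV. u $ i * B $ i $ j * v $ j)"
    by (rule sum.swap)
  also have "\<dots> = (\<Sum>j\<in>UNIV. \<Sum>i\<in>UNIV. v $ j * (B $ j $ i * u $ i))"
    by (intro sum.cong refl) (simp only: sym mult.commute mult.left_commute)
  also have "\<dots> = bprod B v u"
    by (simp add: bprod_eq_sum matrix_vector_mult_def sum_distrib_left)
  finally show ?thesis .
qed

lemma bprod_diff_left: "bprod B (u - v) w = bprod B u w - bprod B v w"
  by (simp add: bprod_eq_sum left_diff_distrib sum_subtractf)

lemma bprod_diff_right: "bprod B u (v - w) = bprod B u v - bprod B u w"
  by (simp add: bprod_eq_sum matrix_vector_mult_diff_distrib right_diff_distrib sum_subtractf)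

lemma bprod_scale_right: "bprod B u (k *s v) = k * bprod B u v"
  by (simp only: bprod_eq_sum vector_scalar_commute vector_smult_component sum_distrib_left
      mult.left_commute)

lemma bprod_add_right: "bprod B u (v + w) = bprod B u v + bprod B u w"
  by (simp add: bprod_eq_sum matrix_vector_right_distrib distrib_left sum.distrib)

lemmas bprod_linear =
  bprod_add_left bprod_add_right bprod_diff_left bprod_diff_right
  bprod_scale_left bprod_scale_right

lemma bform_diff:
  assumes "transpose B = B"
  shows "bform B (u - v) = bform B u + bform B v - 2 * bprod B u v"
  using bprod_commute[OF assms, of u v] by (simp add: bform_def bprod_linear)

text \<open>This turns a system of equations for scalar products with the rows of M into one matrix
  equation.\<close>

lemma matrix_vector_mult_bprod: "((M ** B) *v v) $ i = bprod B (row i M) v"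
proof -
  have "((M ** B) *v v) $ i = (M *v (B *v v)) $ i"
    by (simp only: matrix_vector_mul_assoc)
  also have "\<dots> = bprod B (row i M) v"
    unfolding matrix_vector_mult_def[of M] bprod_eq_sum row_def
    by (simp only: vec_lambda_beta vec_lambda_eta)
  finally show ?thesis .
qed

section \<open>The circumcentre\<close>

lemma two_neq_zero:
  assumes "CHAR('a::field) \<noteq> 2"
  shows "(2::'a) \<noteq> 0"
proof
  assume "(2::'a) = 0"
  then have "CHAR('a) dvd 2"
    using of_nat_eq_0_iff_char_dvd[where 'a = 'a, of 2] by simp
  then have "CHAR('a) = 1 \<or> CHAR('a) = 2"
    using prime_nat_iff two_is_prime_nat by blast
  with assms show False
    using CHAR_not_1 by auto
qed

text \<open>The terms quadratic in P cancel in the difference of the two quadrances.  What remains is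
  affine in P, vanishes at the midpoint and has the edge vector, up to a nonzero factor, as its
  normal with respect to B.\<close>

lemma mem_midplane_iff:
  fixes B :: "'a::field^3^3"
  assumes "CHAR('a) \<noteq> 2" and "transpose B = B"
  shows "P \<in> midplane B X Y \<longleftrightarrow> quadrance B X P = quadrance B Y P"
proof -
  define u where "u = Y - X"
  define w where "w = P - X"
  have mid: "P - edge_midpoint X Y = w - (1 / 2) *s u"
    by (simp add: edge_midpoint_def u_def w_def)
  then have "P \<in> midplane B X Y \<longleftrightarrow> bprod B u w - 1 / 2 * bprod B u u = 0"
    unfolding midplane_def mem_Collect_eq mid
    by (simp add: bprod_diff_right bprod_scale_right flip: u_def)
  also have "\<dots> \<longleftrightarrow> bform B u - 2 * bprod B w u = 0"
    using two_neq_zero[OF assms(1)]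
    by (auto simp: bform_def bprod_commute[OF assms(2), of u w] field_simps)
  also have "\<dots> \<longleftrightarrow> quadrance B X P = quadrance B Y P"
  proof -
    have "P - Y = w - u"
      by (simp add: u_def w_def)
    then show ?thesis
      by (auto simp: quadrance_def bform_diff[OF assms(2)] simp flip: w_def)
  qed
  finally show ?thesis .
qed

text \<open>Equidistance is transitive, so the three edges at A 0 account for all six midplanes.\<close>

lemma circumcentre_equidistant:
  fixes B :: "'a::field^3^3"
  assumes "CHAR('a) \<noteq> 2" and "transpose B = B"
  shows "circumcentre B A =
    (THE C. \<forall>j\<in>{1..3}. quadrance B (A 0) C = quadrance B (A j) C)"
proof -
  have "(\<forall>i j. i < j \<and> j \<le> 3 \<longrightarrow> C \<in> midplane B (A i) (A j)) \<longleftrightarrow>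
    (\<forall>j\<in>{1..3}. quadrance B (A 0) C = quadrance B (A j) C)" (is "?L \<longleftrightarrow> ?R") for C
  proof
    assume ?L
    then show ?R
      by (auto simp: mem_midplane_iff[OF assms])
  next
    assume R: ?R
    have "quadrance B (A 0) C = quadrance B (A j) C" if "j \<le> 3" for j
      using that R by (cases "j = 0") auto
    then show ?L
      using mem_midplane_iff[OF assms] by (metis less_imp_le_nat order_trans)
  qed
  then show ?thesis
    by (simp add: circumcentre_def)
qed

definition edge_matrix :: "(nat \<Rightarrow> 'a::field^3) \<Rightarrow> 'a^3^3" where
  "edge_matrix A = vector [A 1 - A 0, A 2 - A 0, A 3 - A 0]"

lemma row_edge_matrix:
  "row 1 (edge_matrix A) = A 1 - A 0"
  "row 2 (edge_matrix A) = A 2 - A 0"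
  "row 3 (edge_matrix A) = A 3 - A 0"
  by (simp_all add: row_def edge_matrix_def vec_eq_iff)

lemma vector_mult_edge_matrix:
  "t v* edge_matrix A = t $ 1 *s (A 1 - A 0) + t $ 2 *s (A 2 - A 0) + t $ 3 *s (A 3 - A 0)"
  by (simp add: vec_eq_iff vector_matrix_mult_def sum_3 edge_matrix_def right_diff_distrib
      left_diff_distrib mult.commute)

lemma invertible_edge_matrix:
  assumes "tetrahedron A"
  shows "invertible (edge_matrix A)"
  unfolding invertible_right_inverse matrix_right_invertible_independent_rows
proof (intro allI impI)
  fix c :: "3 \<Rightarrow> 'a" and i
  assume sum0: "(\<Sum>i\<in>UNIV. c i *s row i (edge_matrix A)) = 0"
  let ?u = "A 1 - A 0" and ?v = "A 2 - A 0" and ?w = "A 3 - A 0"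
  have "A i \<noteq> A j" if "i \<in> {0..3}" "j \<in> {0..3}" "i \<noteq> j" for i j
    using assms that by (meson inj_onD tetrahedron_def)
  from this[of 1 2] this[of 1 3] this[of 2 3]
  have ne: "?u \<noteq> ?v" "?u \<noteq> ?w" "?v \<noteq> ?w"
    by simp_all
  (* Independence speaks of coefficients attached to vectors, so c is carried over from the row
     indices to the edge vectors; this needs the edge vectors to be distinct. *)
  define k where "k = (\<lambda>x. if x = ?u then c 1 else if x = ?v then c 2 else c 3)"
  have "(\<Sum>x\<in>{?u, ?v, ?w}. k x *s x) = 0"
    using sum0 ne by (simp add: k_def sum_3 row_edge_matrix add.assoc)
  then have "k ?u = 0" "k ?v = 0" "k ?w = 0"
    using assms[unfolded tetrahedron_def]
      vec.independentD[of "{?u, ?v, ?w}" "{?u, ?v, ?w}" k] by blast+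
  then have "c 1 = 0 \<and> c 2 = 0 \<and> c 3 = 0"
    using ne unfolding k_def by presburger
  then show "c i = 0"
    using exhaust_3[of i] by auto
qed

lemma quadrance_eq_iff_bprod:
  fixes B :: "'a::field^3^3"
  assumes "CHAR('a) \<noteq> 2" and "transpose B = B"
  shows "quadrance B X C = quadrance B Y C \<longleftrightarrow> bprod B (Y - X) (C - X) = bform B (Y - X) / 2"
proof -
  have "C - Y = (C - X) - (Y - X)"
    by simp
  then have "quadrance B Y C
      = quadrance B X C + bform B (Y - X) - 2 * bprod B (Y - X) (C - X)"
    unfolding quadrance_def
    by (simp only: bform_diff[OF assms(2)] bprod_commute[OF assms(2), of "C - X"])
  then show ?thesis
    using two_neq_zero[OF assms(1)] by (auto simp: field_simps)
qed

text \<open>The three equidistance conditions form a linear system for the vector from A 0 to C whose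
  matrix is the invertible product of the edge matrix and B.\<close>

lemma ex1_equidistant:
  fixes B :: "'a::field^3^3"
  assumes "CHAR('a) \<noteq> 2" and "transpose B = B" and "invertible B" and "tetrahedron A"
  shows "\<exists>!C. \<forall>j\<in>{1..3}. quadrance B (A 0) C = quadrance B (A j) C"
proof -
  let ?N = "edge_matrix A ** B"
  define h where "h = (\<chi> i. bform B (row i (edge_matrix A)) / 2)"
  have "{1..3} = {1, 2, 3::nat}"
    by auto
  then have eq: "(\<forall>j\<in>{1..3}. quadrance B (A 0) C = quadrance B (A j) C)
      \<longleftrightarrow> ?N *v (C - A 0) = h" for C
    by (simp add: quadrance_eq_iff_bprod[OF assms(1,2)] vec_eq_iff forall_3 h_def
        matrix_vector_mult_bprod row_edge_matrix)
  have "invertible ?N"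
    by (intro invertible_mult invertible_edge_matrix assms)
  then obtain N' where N': "?N ** N' = mat 1" "N' ** ?N = mat 1"
    unfolding invertible_def by blast
  show ?thesis
    unfolding eq
  proof
    show "?N *v (A 0 + N' *v h - A 0) = h"
      using N' by (simp add: matrix_vector_mul_assoc)
  next
    fix C
    assume "?N *v (C - A 0) = h"
    then have "N' *v h = C - A 0"
      using N' by (metis matrix_vector_mul_assoc matrix_vector_mul_lid)
    then show "C = A 0 + N' *v h"
      by simp
  qed
qed

lemma quadrance_circumcentre:
  fixes B :: "'a::field^3^3"
  assumes "CHAR('a) \<noteq> 2" and "transpose B = B" and "invertible B" and "tetrahedron A"
    and "j \<le> 3"
  shows "quadrance B (A j) (circumcentre B A) = quadrance B (A 0) (circumcentre B A)"
proof (cases "j = 0")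
  case False
  have "\<forall>j\<in>{1..3}. quadrance B (A 0) (circumcentre B A) = quadrance B (A j) (circumcentre B A)"
    unfolding circumcentre_equidistant[OF assms(1,2)]
    by (rule theI'[OF ex1_equidistant[OF assms(1-4)]])
  then show ?thesis
    using False \<open>j \<le> 3\<close> by (metis atLeastAtMost_iff less_one not_less)
qed simp

lemma circumquadrance_eq:
  fixes B :: "'a::field^3^3"
  assumes "CHAR('a) \<noteq> 2" and "transpose B = B" and "invertible B" and "tetrahedron A"
  shows "circumquadrance B A = quadrance B (A 0) (circumcentre B A)"
  unfolding circumquadrance_def
proof (rule the_equality)
  show "\<forall>i\<le>3. quadrance B (A 0) (circumcentre B A) = quadrance B (A i) (circumcentre B A)"
    using quadrance_circumcentre[OF assms] by metis
qed blast

section \<open>The identity for the Gram matrix\<close>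

text \<open>The numbers a, b, c are the diagonal entries and d, e, f the off-diagonal entries of the Gram
  matrix, and x, y, z are the coordinates of the circumcentre in the basis of edge vectors.
  In each argument on the right, the first factor is the quadrance of an edge at the origin and the
  second is that of the opposite edge.  Cramer's rule gives the determinant times each coordinate,
  and these products are exactly what the determinant times R is made of.\<close>

lemma gram_circumradius_identity:
  fixes a b c d e f x y z R :: "'a::field"
  assumes eq1: "2 * (a * x + d * y + e * z) = a"
    and eq2: "2 * (d * x + b * y + f * z) = b"
    and eq3: "2 * (e * x + f * y + c * z) = c"
    and R: "2 * R = a * x + b * y + c * z"
  shows "16 * (a * b * c + 2 * d * e * f - a * f^2 - b * e^2 - c * d^2) * R =
    archimedes (a * (b + c - 2 * f)) (b * (a + c - 2 * e)) (c * (a + b - 2 * d))"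
proof -
  define D where "D = a * b * c + 2 * d * e * f - a * f^2 - b * e^2 - c * d^2"
  (* The coefficients of the three equations are the entries of a row of the adjugate. *)
  let ?e1 = "2 * (a * x + d * y + e * z)" and ?e2 = "2 * (d * x + b * y + f * z)"
    and ?e3 = "2 * (e * x + f * y + c * z)"
  have "2 * D * x = (b * c - f^2) * ?e1 + (e * f - c * d) * ?e2 + (d * f - b * e) * ?e3"
    by (simp add: D_def algebra_simps power2_eq_square)
  then have x: "2 * D * x = (b * c - f^2) * a + (e * f - c * d) * b + (d * f - b * e) * c"
    by (simp only: eq1 eq2 eq3)
  have "2 * D * y = (e * f - c * d) * ?e1 + (a * c - e^2) * ?e2 + (d * e - a * f) * ?e3"
    by (simp add: D_def algebra_simps power2_eq_square)
  then have y: "2 * D * y = (e * f - c * d) * a + (a * c - e^2) * b + (d * e - a * f) * c"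
    by (simp only: eq1 eq2 eq3)
  have "2 * D * z = (d * f - b * e) * ?e1 + (d * e - a * f) * ?e2 + (a * b - d^2) * ?e3"
    by (simp add: D_def algebra_simps power2_eq_square)
  then have z: "2 * D * z = (d * f - b * e) * a + (d * e - a * f) * b + (a * b - d^2) * c"
    by (simp only: eq1 eq2 eq3)
  have "16 * D * R = 8 * D * (2 * R)"
    by simp
  also have "\<dots> = 4 * (a * (2 * D * x) + b * (2 * D * y) + c * (2 * D * z))"
    unfolding R by (simp add: algebra_simps)
  also have "\<dots> = archimedes (a * (b + c - 2 * f)) (b * (a + c - 2 * e)) (c * (a + b - 2 * d))"
    unfolding x y z archimedes_def by (simp add: algebra_simps power2_eq_square)
  finally show ?thesis
    by (simp add: D_def)
qed

theorem theorem3: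
  fixes B :: "'a::field^3^3" and A :: "nat \<Rightarrow> 'a^3" and Q :: "nat \<Rightarrow> nat \<Rightarrow> 'a"
  assumes "CHAR('a) \<noteq> 2" and "CHAR('a) \<noteq> 3"
    and "transpose B = B" and "invertible B"
    and "tetrahedron A"
    and Q: "\<And>i j. i < j \<Longrightarrow> j \<le> 3 \<Longrightarrow> Q i j = quadrance B (A i) (A j)"
  shows "4 * quadrume B A * circumquadrance B A =
    archimedes (Q 0 1 * Q 2 3) (Q 0 2 * Q 1 3) (Q 0 3 * Q 1 2)"
proof -
  note two = two_neq_zero[OF assms(1)]
  define u v w where "u = A 1 - A 0" and "v = A 2 - A 0" and "w = A 3 - A 0"
  define C where "C = circumcentre B A - A 0"
  define a b c where "a = bform B u" and "b = bform B v" and "c = bform B w"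
  define d e f where "d = bprod B u v" and "e = bprod B u w" and "f = bprod B v w"
  define R where "R = circumquadrance B A"
  have sym: "bprod B v u = d" "bprod B w u = e" "bprod B w v = f"
    by (simp_all add: d_def e_def f_def bprod_commute[OF assms(3)])
  have q0: "quadrance B (A 0) (A 1) = a" "quadrance B (A 0) (A 2) = b"
    "quadrance B (A 0) (A 3) = c"
    by (simp_all add: quadrance_def a_def b_def c_def u_def v_def w_def)
  have "A 2 - A 1 = v - u" "A 3 - A 1 = w - u" "A 3 - A 2 = w - v"
    by (simp_all add: u_def v_def w_def)
  then have q1: "quadrance B (A 1) (A 2) = a + b - 2 * d" "quadrance B (A 1) (A 3) = a + c - 2 * e"
    "quadrance B (A 2) (A 3) = b + c - 2 * f"
    by (simp_all add: quadrance_def bform_diff[OF assms(3)] sym flip: a_def b_def c_def)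

  have "4 * quadrume B A = 2 * det (vector [vector [2 * a, 2 * d, 2 * e],
      vector [2 * d, 2 * b, 2 * f], vector [2 * e, 2 * f, 2 * c]] :: 'a^3^3)"
    unfolding quadrume_def Let_def q0 q1 using two by (simp add: divide_simps)
  also have "\<dots> = 16 * (a * b * c + 2 * d * e * f - a * f^2 - b * e^2 - c * d^2)"
    by (simp add: det_3 algebra_simps power2_eq_square)
  finally have V: "4 * quadrume B A
    = 16 * (a * b * c + 2 * d * e * f - a * f^2 - b * e^2 - c * d^2)" .

  have "2 * bprod B (A j - A 0) C = bform B (A j - A 0)" if "j \<le> 3" for j
  proof -
    have "bprod B (A j - A 0) C = bform B (A j - A 0) / 2"
      unfolding C_def quadrance_eq_iff_bprod[OF assms(1,3), symmetric]
      by (rule quadrance_circumcentre[OF assms(1,3-5) that, symmetric])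
    with two show ?thesis
      by (simp add: mult.commute)
  qed
  from this[of 1] this[of 2] this[of 3]
  have uC: "2 * bprod B u C = a" and vC: "2 * bprod B v C = b" and wC: "2 * bprod B w C = c"
    unfolding u_def v_def w_def a_def b_def c_def by simp_all

  obtain M' where "M' ** edge_matrix A = mat 1"
    using invertible_edge_matrix[OF assms(5)] by (auto simp: invertible_def)
  then have "C = (C v* M') v* edge_matrix A"
    by (simp add: vector_matrix_mul_assoc)
  then obtain t where "C = t v* edge_matrix A"
    by (rule that)
  then have C: "C = t $ 1 *s u + t $ 2 *s v + t $ 3 *s w"
    unfolding vector_mult_edge_matrix u_def v_def w_def .
  have gram: "bprod B u C = a * t $ 1 + d * t $ 2 + e * t $ 3"
    "bprod B v C = d * t $ 1 + b * t $ 2 + f * t $ 3"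
    "bprod B w C = e * t $ 1 + f * t $ 2 + c * t $ 3"
    unfolding C bprod_add_right bprod_scale_right sym
    by (simp_all add: a_def b_def c_def d_def e_def f_def bform_def mult.commute)
  have "16 * (a * b * c + 2 * d * e * f - a * f^2 - b * e^2 - c * d^2) * R =
    archimedes (a * (b + c - 2 * f)) (b * (a + c - 2 * e)) (c * (a + b - 2 * d))"
  proof (rule gram_circumradius_identity)
    show "2 * (a * t $ 1 + d * t $ 2 + e * t $ 3) = a"
      using uC by (simp only: gram)
    show "2 * (d * t $ 1 + b * t $ 2 + f * t $ 3) = b"
      using vC by (simp only: gram)
    show "2 * (e * t $ 1 + f * t $ 2 + c * t $ 3) = c"
      using wC by (simp only: gram)
    have "R = bprod B C C"
      unfolding R_def circumquadrance_eq[OF assms(1,3-5)] quadrance_def bform_def C_def ..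
    also have "\<dots> = t $ 1 * bprod B u C + t $ 2 * bprod B v C + t $ 3 * bprod B w C"
      by (subst (1) C) (simp only: bprod_add_left bprod_scale_left)
    finally have "2 * R = (2 * bprod B u C) * t $ 1 + (2 * bprod B v C) * t $ 2
        + (2 * bprod B w C) * t $ 3"
      by (simp add: algebra_simps)
    then show "2 * R = a * t $ 1 + b * t $ 2 + c * t $ 3"
      by (simp only: uC vC wC)
  qed
  moreover have "Q 0 1 = a" "Q 0 2 = b" "Q 0 3 = c" "Q 1 2 = a + b - 2 * d"
    "Q 1 3 = a + c - 2 * e" "Q 2 3 = b + c - 2 * f"
    by (simp_all only: Q q0 q1)
  ultimately show ?thesis
    by (simp only: V R_def)
qed

end
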